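(* Let $Z'_{3;1}(n)=Z_{3;1}(n)/n!$, where $Z_{3;1}(n)=\sum_{p\vdash n,\ p_1>0}\mathrm{Sym}(p)$ is the sum of symmetry factors over partitions of $n$ having at least one part equal to $1$. For integers $0\le K\le n$ let $$S'_{3;1;K}(n)=1+\sum_{k=2}^{K}\frac{1}{n(n-1)\cdots(n-k+1)}\sum_{\substack{q\vdash k\\ q_1=0}}\mathrm{Sym}(q).$$ Then $Z'_{3;1}(n)$ is asymptotic, as $n\to\infty$, to the sequence $(S'_{3;1;K}(n))_{K\ge 0}$; that is, for every fixed integer $K\ge 0$, $$\lim_{n\to\infty} n^K\bigl(Z'_{3;1}(n)-S'_{3;1;K}(n)\bigr)=0.$$
   Context: A partition $p\vdash n$ is specified by non-negative integers $(p_1,\dots,p_n)$ with $\sum_i i\,p_i=n$, where $p_i$ is the number of parts of length $i$. Its symmetry factor is $\mathrm{Sym}(p)=\prod_{i=1}^n i^{p_i}\,p_i!$ (the order of the centralizer in $S_n$ of a permutation with cycle type $p$). The condition $q_1=0$ means that $q$ has no part equal to $1$. An empty sum is $0$. *)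

theory Defs
  imports Complex_Main
begin

text \<open>
  A partition is given by its multiplicities: \<open>p i\<close> is the number of parts of length \<open>i\<close>.
  The tuple \<open>(p 1, \<dots>, p n)\<close> is encoded as a function on all naturals that is \<open>0\<close> outside
  \<open>{1..n}\<close>, so that every partition has exactly one representative.
\<close>
definition partitions :: "nat \<Rightarrow> (nat \<Rightarrow> nat) set" where
  "partitions n = {p. (\<forall>i. i \<notin> {1..n} \<longrightarrow> p i = 0) \<and> (\<Sum>i=1..n. i * p i) = n}"

lemma finite_partitions: "finite (partitions n)"
proof -
  have "partitions n \<subseteq> {p. \<forall>i. (i \<in> {1..n} \<longrightarrow> p i \<in> {0..n}) \<and> (i \<notin> {1..n} \<longrightarrow> p i = 0)}"
  proof
    fix p assume p: "p \<in> partitions n"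
    have "p i \<le> n" if i: "i \<in> {1..n}" for i
    proof -
      have "p i \<le> i * p i" using i by simp
      also have "\<dots> \<le> (\<Sum>i=1..n. i * p i)" using i by (intro member_le_sum) auto
      also have "\<dots> = n" using p by (simp add: partitions_def)
      finally show ?thesis .
    qed
    then show "p \<in> {p. \<forall>i. (i \<in> {1..n} \<longrightarrow> p i \<in> {0..n}) \<and> (i \<notin> {1..n} \<longrightarrow> p i = 0)}"
      using p by (auto simp: partitions_def)
  qed
  then show ?thesis
    by (rule finite_subset) (intro finite_set_of_finite_funs; simp)
qed

definition Sym :: "nat \<Rightarrow> (nat \<Rightarrow> nat) \<Rightarrow> nat" where
  "Sym n p = (\<Prod>i=1..n. i ^ p i * fact (p i))"

definition Z31 :: "nat \<Rightarrow> nat" where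
  "Z31 n = (\<Sum>p\<in>{p \<in> partitions n. p 1 > 0}. Sym n p)"

definition Z31' :: "nat \<Rightarrow> real" where
  "Z31' n = real (Z31 n) / fact n"

text \<open>
  Only meaningful for \<open>K \<le> n\<close>: for \<open>k > n\<close> the product in the denominator vanishes
  and the corresponding summand is \<open>0\<close>. This does not affect limits in \<open>n\<close> for fixed \<open>K\<close>.
\<close>
definition S31' :: "nat \<Rightarrow> nat \<Rightarrow> real" where
  "S31' K n = 1 + (\<Sum>k=2..K. 1 / (\<Prod>i<k. real n - real i) *
     real (\<Sum>q\<in>{q \<in> partitions k. q 1 = 0}. Sym k q))"

end

theory Submission
  imports Defs "HOL-Library.FuncSet"
begin

text \<open>
  Let \<open>a k\<close> be the sum of the symmetry factors over the partitions of \<open>k\<close> without part \<open>1\<close>.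
  Sorting the partitions of \<open>n\<close> by the number \<open>n - k > 0\<close> of their parts \<open>1\<close> gives
  \<open>Z31 n = (\<Sum>k<n. (n - k)! * a k)\<close>, so the error \<open>Z31' n - S31' K n\<close> is the tail
  \<open>K < k < n\<close> of the sum of \<open>a k / k! / (n choose k)\<close>. As \<open>n choose k \<ge> (n / k) ^ (K + 1)\<close> for
  these \<open>k\<close>, it is at most \<open>n ^ -(K + 1)\<close> times the sum of \<open>k ^ (K + 1) * a k / k!\<close>. The latter
  converges: a partition without part \<open>1\<close> has at most \<open>k / 2\<close> parts, which gives
  \<open>a k \<le> 8 ^ k * (k div 2)!\<close>.
\<close>

section \<open>Splitting off the parts 1\<close>

definition Sym_sum_no_ones :: "nat \<Rightarrow> nat" where
  "Sym_sum_no_ones k = (\<Sum>q\<in>{q \<in> partitions k. q 1 = 0}. Sym k q)"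

text \<open>Extends the sum to the common range up to \<open>n\<close>, so that partitions of
  \<open>k\<close> and of \<open>n\<close> can be compared termwise.\<close>

lemma partitions_iff:
  assumes "k \<le> n"
  shows "q \<in> partitions k \<longleftrightarrow>
    (\<forall>i. i \<notin> {1..k} \<longrightarrow> q i = 0) \<and> (\<Sum>i=1..n. i * q i) = k"
proof -
  have "(\<Sum>i=1..n. i * q i) = (\<Sum>i=1..k. i * q i)" if "\<forall>i. i \<notin> {1..k} \<longrightarrow> q i = 0"
    using assms that by (intro sum.mono_neutral_right) auto
  then show ?thesis
    by (auto simp: partitions_def)
qed

lemma Sym_eq_prod:
  assumes "k \<le> n" "q \<in> partitions k"
  shows "Sym k q = (\<Prod>i=1..n. i ^ q i * fact (q i))"
  unfolding Sym_def using assms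
  by (intro prod.mono_neutral_left) (auto simp: partitions_def)

lemma sum_split_one:
  fixes f :: "nat \<Rightarrow> 'a::comm_monoid_add"
  assumes "n \<ge> 1"
  shows "(\<Sum>i=1..n. f i) = f 1 + (\<Sum>i=2..n. f i)"
  using assms by (simp add: sum.atLeast_Suc_atMost numeral_2_eq_2)

lemma prod_split_one:
  fixes f :: "nat \<Rightarrow> 'a::comm_monoid_mult"
  assumes "n \<ge> 1"
  shows "(\<Prod>i=1..n. f i) = f 1 * (\<Prod>i=2..n. f i)"
  using assms by (simp add: prod.atLeast_Suc_atMost numeral_2_eq_2)

text \<open>The \<open>n - k\<close> new parts 1 contribute the factor
  \<open>1 ^ (n - k) * fact (n - k)\<close>. Since \<open>q 1 = 0\<close>, the factor of
  \<open>Sym k q\<close> at 1 that they replace equals 1.\<close>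

lemma partitions_add_ones:
  assumes "k < n" "q \<in> partitions k" "q 1 = 0"
  shows "q(1 := n - k) \<in> partitions n"
    and "Sym n (q(1 := n - k)) = fact (n - k) * Sym k q"
proof -
  have q: "\<forall>i. i \<notin> {1..k} \<longrightarrow> q i = 0" "(\<Sum>i=1..n. i * q i) = k"
    using assms partitions_iff[of k n q] by auto
  have "(\<Sum>i=1..n. i * (q(1 := n - k)) i) = n - k + (\<Sum>i=2..n. i * q i)"
    using assms by (subst sum_split_one) (auto intro!: sum.cong)
  also have "(\<Sum>i=2..n. i * q i) = k"
    using q(2) assms by (subst (asm) sum_split_one) auto
  finally show "q(1 := n - k) \<in> partitions n"
    using q(1) assms by (auto simp: partitions_def)
  have "Sym n (q(1 := n - k)) = fact (n - k) * (\<Prod>i=2..n. i ^ q i * fact (q i))"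
    unfolding Sym_def using assms by (subst prod_split_one) (auto intro!: prod.cong)
  also have "(\<Prod>i=2..n. i ^ q i * fact (q i)) = Sym k q"
    using assms by (subst Sym_eq_prod[of k n], simp, simp, subst prod_split_one) auto
  finally show "Sym n (q(1 := n - k)) = fact (n - k) * Sym k q" .
qed

lemma partitions_remove_ones:
  assumes "p \<in> partitions n" "n \<ge> 1"
  shows "p 1 \<le> n" "p(1 := 0) \<in> partitions (n - p 1)"
proof -
  have p: "\<forall>i. i \<notin> {1..n} \<longrightarrow> p i = 0" "p 1 + (\<Sum>i=2..n. i * p i) = n"
    using assms sum_split_one[of n "\<lambda>i. i * p i"] by (auto simp: partitions_def)
  from p(2) show "p 1 \<le> n" by linarith
  \<comment> \<open>Any remaining part \<open>i\<close> satisfies \<open>i \<le> i * p i\<close>,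
    which is at most the total weight \<open>n - p 1\<close> of the parts other than 1.\<close>
  have "p i = 0" if "i \<noteq> 1" "i \<notin> {1..n - p 1}" for i
  proof (rule ccontr)
    assume "p i \<noteq> 0"
    then have i: "i \<in> {2..n}" using p(1) that by (cases "i \<in> {1..n}") auto
    have "i \<le> i * p i" using \<open>p i \<noteq> 0\<close> by simp
    also have "\<dots> \<le> (\<Sum>i=2..n. i * p i)"
      using i by (intro member_le_sum) auto
    finally have "i \<le> n - p 1" using p(2) by linarith
    then show False using that i by auto
  qed
  moreover have "(\<Sum>i=1..n. i * (p(1 := 0)) i) = (\<Sum>i=2..n. i * p i)"
    using assms(2) by (subst sum_split_one) (auto intro!: sum.cong)
  ultimately show "p(1 := 0) \<in> partitions (n - p 1)"
    using p(2) by (subst partitions_iff[of _ n]) auto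
qed

lemma Z31_eq_sum: "Z31 n = (\<Sum>k<n. fact (n - k) * Sym_sum_no_ones k)"
proof -
  define S where "S = (SIGMA k:{..<n}. {q \<in> partitions k. q 1 = 0})"
  \<comment> \<open>The index \<open>k = n - p 1\<close> is the weight of the parts other than 1.
    The range \<open>k < n\<close> expresses \<open>p 1 > 0\<close>.\<close>
  have "Z31 n = (\<Sum>(k, q)\<in>S. fact (n - k) * Sym k q)"
    unfolding Z31_def
  proof (rule sum.reindex_bij_witness[where i = "\<lambda>(k, q). q(1 := n - k)"
        and j = "\<lambda>p. (n - p 1, p(1 := 0))"], goal_cases)
    case (1 p)
    then have "n \<ge> 1" by (cases n) (auto simp: partitions_def)
    then show ?case using 1 partitions_remove_ones(1)[of p n] by auto
  next
    case (2 p)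
    then have "n \<ge> 1" by (cases n) (auto simp: partitions_def)
    then show ?case using 2 partitions_remove_ones[of p n] by (auto simp: S_def)
  next
    case (3 x)
    then show ?case by (auto simp: S_def fun_eq_iff)
  next
    case (4 x)
    then show ?case using partitions_add_ones(1) by (auto simp: S_def)
  next
    case (5 p)
    then have n: "n \<ge> 1" by (cases n) (auto simp: partitions_def)
    then show ?case
      using 5 partitions_remove_ones[of p n] partitions_add_ones(2)[of "n - p 1" n "p(1 := 0)"]
      by auto
  qed
  also have "\<dots> = (\<Sum>k<n. fact (n - k) * Sym_sum_no_ones k)"
    unfolding S_def Sym_sum_no_ones_def sum_distrib_left
    by (subst sum.Sigma[symmetric]) (auto simp: finite_partitions)
  finally show ?thesis .
qed

section \<open>The error as a tail sum\<close>

lemma Sym_sum_no_ones_0: "Sym_sum_no_ones 0 = 1"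
proof -
  have "{q \<in> partitions 0. q 1 = 0} = {\<lambda>_. 0}"
    by (auto simp: partitions_def)
  then show ?thesis by (simp add: Sym_sum_no_ones_def Sym_def)
qed

lemma Sym_sum_no_ones_1: "Sym_sum_no_ones 1 = 0"
proof -
  have "{q \<in> partitions 1. q 1 = 0} = {}"
    by (auto simp: partitions_def)
  then show ?thesis unfolding Sym_sum_no_ones_def by (simp only: sum.empty)
qed

lemma prod_falling:
  assumes "k \<le> n"
  shows "(\<Prod>i<k. real n - real i) = fact n / fact (n - k)"
  using assms
proof (induction k)
  case (Suc k)
  have "fact (n - k) = real (n - k) * fact (n - Suc k)"
    using Suc.prems by (metis Suc_diff_Suc Suc_le_lessD fact_Suc of_nat_fact of_nat_mult)
  then have "(fact (n - k) :: real) = (real n - real k) * fact (n - Suc k)"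
    using Suc.prems by (simp add: of_nat_diff)
  moreover have "(\<Prod>i<k. real n - real i) = fact n / fact (n - k)"
    using Suc by simp
  ultimately show ?case using Suc.prems by simp
qed simp

text \<open>The leading 1 of \<open>S31'\<close> is the term \<open>k = 0\<close>, and the term
  \<open>k = 1\<close> vanishes because the only partition of 1 has a part 1.\<close>

lemma S31'_eq_sum:
  assumes "K \<le> n"
  shows "S31' K n = (\<Sum>k\<le>K. fact (n - k) / fact n * real (Sym_sum_no_ones k))"
proof -
  define t where "t k = fact (n - k) / fact n * real (Sym_sum_no_ones k)" for k
  have "S31' K n = 1 + (\<Sum>k=2..K. t k)"
    unfolding S31'_def Sym_sum_no_ones_def[symmetric] t_def using assms
    by (intro arg_cong2[where f = "(+)"] sum.cong) (auto simp: prod_falling)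
  also have "(\<Sum>k=2..K. t k) = (\<Sum>k\<in>{..K} - {0}. t k)"
  proof (rule sum.mono_neutral_left)
    show "\<forall>k\<in>{..K} - {0} - {2..K}. t k = 0"
    proof
      fix k assume "k \<in> {..K} - {0} - {2..K}"
      then have "k = 1" by auto
      then show "t k = 0" unfolding t_def using Sym_sum_no_ones_1 by simp
    qed
  qed auto
  also have "1 + \<dots> = (\<Sum>k\<le>K. t k)"
    by (subst sum.remove[of "{..K}" 0]) (auto simp: t_def Sym_sum_no_ones_0)
  finally show ?thesis by (simp add: t_def)
qed

lemma Z31'_minus_S31':
  assumes "K < n"
  shows "Z31' n - S31' K n =
    (\<Sum>k\<in>{K<..<n}. real (Sym_sum_no_ones k) / fact k / real (n choose k))"
proof -
  have "Z31' n = (\<Sum>k<n. fact (n - k) / fact n * real (Sym_sum_no_ones k))"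
    by (simp add: Z31'_def Z31_eq_sum sum_divide_distrib)
  also have "{..<n} = {..K} \<union> {K<..<n}" using assms by auto
  also have "(\<Sum>k\<in>\<dots>. fact (n - k) / fact n * real (Sym_sum_no_ones k)) =
      S31' K n + (\<Sum>k\<in>{K<..<n}. fact (n - k) / fact n * real (Sym_sum_no_ones k))"
    using assms by (subst sum.union_disjoint) (auto simp: S31'_eq_sum)
  also have "(\<Sum>k\<in>{K<..<n}. fact (n - k) / fact n * real (Sym_sum_no_ones k)) =
      (\<Sum>k\<in>{K<..<n}. real (Sym_sum_no_ones k) / fact k / real (n choose k))"
    by (intro sum.cong) (auto simp: binomial_fact)
  finally show ?thesis by simp
qed

section \<open>Growth of the symmetry sums\<close>

text \<open>A part \<open>i\<close> occurs at most \<open>k div i\<close> times, so the partitions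
  embed into a box with \<Prod>(1 + \<open>k div i\<close>) points. This product is at most
  \<Prod>(k + i) / i, the central binomial coefficient \<open>(k + k) choose k\<close>.\<close>

lemma card_partitions_le: "card (partitions k) \<le> 4 ^ k"
proof -
  define B where "B = (\<Pi>\<^sub>E i\<in>{1..k}. {..k div i})"
  have "card (partitions k) \<le> card B"
  proof (rule card_inj_on_le)
    show "inj_on (\<lambda>q. restrict q {1..k}) (partitions k)"
    proof (rule inj_onI, rule ext)
      fix p q i assume *: "p \<in> partitions k" "q \<in> partitions k"
        "restrict p {1..k} = restrict q {1..k}"
      show "p i = q i"
      proof (cases "i \<in> {1..k}")
        case True
        then show ?thesis using *(3) by (metis restrict_apply')
      next
        case False
        then show ?thesis using *(1,2) by (simp add: partitions_def)
      qed
    qed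
    show "(\<lambda>q. restrict q {1..k}) ` partitions k \<subseteq> B"
    proof (rule image_subsetI)
      fix q assume q: "q \<in> partitions k"
      have "q i \<le> k div i" if "i \<in> {1..k}" for i
      proof -
        have "i * q i \<le> (\<Sum>i=1..k. i * q i)"
          using that by (intro member_le_sum) auto
        then have "i * q i \<le> k" using q by (simp add: partitions_def)
        then show ?thesis using that by (simp add: less_eq_div_iff_mult_less_eq mult.commute)
      qed
      then show "restrict q {1..k} \<in> B" by (auto simp: B_def)
    qed
    show "finite B" unfolding B_def by (intro finite_PiE) auto
  qed
  also have "real (card B) \<le> 4 ^ k"
  proof -
    have "real (card B) = (\<Prod>i=1..k. 1 + real (k div i))"
      by (simp add: B_def card_PiE)
    also have "\<dots> \<le> (\<Prod>i=1..k. real (k + i) / real i)"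
    proof (rule prod_mono)
      fix i assume "i \<in> {1..k}"
      then show "0 \<le> 1 + real (k div i) \<and> 1 + real (k div i) \<le> real (k + i) / real i"
        using of_nat_div_le_of_nat[of k i, where 'a = real] by (auto simp: add_divide_distrib)
    qed
    also have "\<dots> = real ((k + k) choose k)"
    proof -
      \<comment> \<open>The upper limit \<open>m\<close> is decoupled from \<open>k\<close>, so that
        the induction can run over \<open>m\<close> with \<open>k\<close> fixed.\<close>
      have "(\<Prod>i=1..m. real (k + i) / real i) = real ((k + m) choose m)" for m
      proof (induction m)
        case (Suc m)
        have "Suc m * ((k + Suc m) choose Suc m) = (k + Suc m) * ((k + m) choose m)"
          using Suc_times_binomial_eq[of "k + m" m] by (simp add: mult.commute)
        then have "real (Suc m) * real ((k + Suc m) choose Suc m) =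
            real (k + Suc m) * real ((k + m) choose m)"
          by (metis of_nat_mult)
        then show ?case using Suc by (simp add: field_simps del: binomial_Suc_Suc)
      qed simp
      then show ?thesis .
    qed
    also have "\<dots> \<le> real (2 ^ (k + k))"
      by (intro of_nat_mono binomial_le_pow2)
    also have "\<dots> = 4 ^ k" by (simp add: power_add flip: power_mult_distrib)
    finally show ?thesis .
  qed
  then have "card B \<le> 4 ^ k"
    by (metis numeral_power_le_of_nat_cancel_iff of_nat_le_iff of_nat_numeral of_nat_power)
  finally show ?thesis .
qed

text \<open>The quotient is a multinomial coefficient.\<close>

lemma prod_fact_dvd_fact_sum:
  fixes f :: "'a \<Rightarrow> nat"
  shows "(\<Prod>i\<in>A. fact (f i)) dvd (fact (\<Sum>i\<in>A. f i) :: nat)"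
proof (induction A rule: infinite_finite_induct)
  case (insert x A)
  then have "(\<Prod>i\<in>insert x A. fact (f i)) dvd (fact (f x) * fact (sum f A) :: nat)"
    by (simp add: mult_dvd_mono)
  also have "\<dots> dvd fact (f x + sum f A)" by (rule fact_fact_dvd_fact)
  finally show ?case using insert by simp
qed auto

text \<open>By \<open>i < 2 ^ i\<close>, the powers multiply to at most 2 to the weight
  \<open>k\<close>. All parts are at least 2, so there are at most \<open>k div 2\<close> of them,
  and the product of the factorials is at most the factorial of the number of parts.\<close>

lemma Sym_no_ones_le:
  assumes "q \<in> partitions k" "q 1 = 0"
  shows "Sym k q \<le> 2 ^ k * fact (k div 2)"
proof -
  have q: "\<forall>i. i \<notin> {1..k} \<longrightarrow> q i = 0" "(\<Sum>i=1..k. i * q i) = k"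
    using assms by (auto simp: partitions_def)
  have "(\<Prod>i=1..k. i ^ q i) \<le> (\<Prod>i=1..k. (2 ^ i) ^ q i)"
    by (intro prod_mono) (auto intro!: power_mono less_imp_le[OF less_exp])
  also have "\<dots> = 2 ^ (\<Sum>i=1..k. i * q i)" by (simp add: power_sum power_mult)
  also have "\<dots> = 2 ^ k" by (simp only: q(2))
  finally have 1: "(\<Prod>i=1..k. i ^ q i) \<le> 2 ^ k" .
  have "2 * (\<Sum>i=1..k. q i) \<le> (\<Sum>i=1..k. i * q i)"
    unfolding sum_distrib_left
  proof (rule sum_mono)
    fix i assume "i \<in> {1..k}"
    then show "2 * q i \<le> i * q i" using assms(2) by (cases "i = 1") auto
  qed
  then have "(\<Sum>i=1..k. q i) \<le> k div 2" using q(2) by linarith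
  moreover have "(\<Prod>i=1..k. fact (q i)) \<le> (fact (\<Sum>i=1..k. q i) :: nat)"
    by (intro dvd_imp_le prod_fact_dvd_fact_sum) auto
  ultimately have 2: "(\<Prod>i=1..k. fact (q i)) \<le> (fact (k div 2) :: nat)"
    by (meson fact_mono_nat le_trans)
  show ?thesis unfolding Sym_def prod.distrib using 1 2 by (rule mult_le_mono)
qed

lemma Sym_sum_no_ones_le: "Sym_sum_no_ones k \<le> 8 ^ k * fact (k div 2)"
proof -
  have "Sym_sum_no_ones k \<le> card {q \<in> partitions k. q 1 = 0} * (2 ^ k * fact (k div 2))"
    unfolding Sym_sum_no_ones_def using sum_bounded_above Sym_no_ones_le
    by (metis (mono_tags, lifting) mem_Collect_eq of_nat_id)
  also have "card {q \<in> partitions k. q 1 = 0} \<le> 4 ^ k"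
    using card_partitions_le card_mono[OF finite_partitions, of "{q \<in> partitions k. q 1 = 0}" k]
    by (force intro: le_trans)
  finally show ?thesis by (simp flip: power_mult_distrib mult.assoc)
qed

section \<open>A geometric majorant and the limit\<close>

text \<open>A single term of the exponential series is at most its sum.\<close>

lemma power_le_fact_mult_exp:
  fixes x :: real
  assumes "x \<ge> 0"
  shows "x ^ m \<le> fact m * exp x"
proof -
  have "(\<Sum>k\<in>{m}. x ^ k / fact k) \<le> exp x"
    using assms sum_le_suminf[OF summable_exp[of x], of "{m}"]
    by (auto simp: exp_def field_simps)
  then show ?thesis by (simp add: field_simps)
qed

text \<open>Here 48 = 8 * 3 * 2: the 8 comes from \<open>Sym_sum_no_ones_le\<close>, the 3 from
  bounding \<open>real k ^ j\<close> through \<open>exp (real k)\<close>, and the 2 pays for the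
  decay \<open>(1 / 2) ^ k\<close>. With \<open>m = k div 2\<close>, dividing by
  \<open>fact k\<close> leaves a factor \<open>1 / fact m\<close>, which beats
  \<open>48 ^ k\<close>.\<close>

lemma weighted_Sym_sum_no_ones_le:
  "real k ^ j * (real (Sym_sum_no_ones k) / fact k) \<le> 48 * fact j * exp (48\<^sup>2) * (1 / 2) ^ k"
proof -
  define m where "m = k div 2"
  have "fact m * fact m \<le> (fact k :: nat)"
  proof -
    have "fact m * fact m \<le> (fact (m + m) :: nat)"
      by (intro dvd_imp_le fact_fact_dvd_fact) auto
    also have "\<dots> \<le> fact k" by (intro fact_mono_nat) (simp add: m_def)
    finally show ?thesis .
  qed
  then have fact_k: "fact m * fact m \<le> (fact k :: real)"
    by (metis of_nat_fact of_nat_le_iff of_nat_mult)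
  have "real (Sym_sum_no_ones k) \<le> 8 ^ k * fact m"
    using Sym_sum_no_ones_le[of k] of_nat_mono[of _ "8 ^ k * fact m", where 'a = real]
    by (simp add: m_def)
  then have "real (Sym_sum_no_ones k) / fact k \<le> 8 ^ k * fact m / (fact m * fact m)"
    using fact_k by (intro frac_le) auto
  then have 1: "real (Sym_sum_no_ones k) / fact k \<le> 8 ^ k / fact m" by simp
  have "real k ^ j \<le> fact j * exp (real k)" by (rule power_le_fact_mult_exp) simp
  also have "exp (real k) \<le> 3 ^ k"
    using exp_le by (simp add: exp_of_nat_mult[of k 1, simplified] power_mono)
  finally have 2: "real k ^ j \<le> fact j * 3 ^ k" by simp
  \<comment> \<open>The 1 covers odd \<open>k\<close> and accounts for the factor 48 in
    front.\<close>
  have "48 ^ k \<le> (48 ^ (2 * m + 1) :: real)"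
    by (intro power_increasing) (auto simp: m_def)
  also have "\<dots> = 48 * (48\<^sup>2) ^ m" by (simp add: power_mult)
  also have "\<dots> \<le> 48 * (fact m * exp (48\<^sup>2))"
    by (intro mult_left_mono power_le_fact_mult_exp) auto
  finally have 3: "48 ^ k / fact m \<le> 48 * exp (48\<^sup>2 :: real)" by (simp add: field_simps)
  have "real k ^ j * (real (Sym_sum_no_ones k) / fact k) \<le> (fact j * 3 ^ k) * (8 ^ k / fact m)"
    using 1 2 by (intro mult_mono) auto
  also have "\<dots> = fact j * (1 / 2) ^ k * (48 ^ k / fact m)"
    by (simp add: field_simps flip: power_mult_distrib)
  also have "\<dots> \<le> fact j * (1 / 2) ^ k * (48 * exp (48\<^sup>2))"
    using 3 by (intro mult_left_mono) auto
  finally show ?thesis by (simp add: mult_ac)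
qed

text \<open>The error is controlled with one power of \<open>n\<close> more than the limit requires.
  The constant 96 is 48 times 2, the sum of the geometric series.\<close>

lemma Z31'_minus_S31'_bounds:
  assumes "K < n"
  shows "0 \<le> Z31' n - S31' K n"
    and "real n ^ Suc K * (Z31' n - S31' K n) \<le> 96 * fact (Suc K) * exp (48\<^sup>2)"
proof -
  show "0 \<le> Z31' n - S31' K n"
    using assms by (simp add: Z31'_minus_S31' sum_nonneg)
  define C :: real where "C = 48 * fact (Suc K) * exp (48\<^sup>2)"
  have "real n ^ Suc K * (Z31' n - S31' K n) =
      (\<Sum>k\<in>{K<..<n}. real n ^ Suc K * (real (Sym_sum_no_ones k) / fact k / real (n choose k)))"
    using assms by (simp only: Z31'_minus_S31' sum_distrib_left)
  also have "\<dots> \<le> (\<Sum>k\<in>{K<..<n}. C * (1 / 2) ^ k)"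
  proof (rule sum_mono)
    fix k assume k: "k \<in> {K<..<n}"
    \<comment> \<open>The base is at least 1 as \<open>0 < k < n\<close>, and
      \<open>Suc K \<le> k\<close>.\<close>
    have "(real n / real k) ^ Suc K \<le> (real n / real k) ^ k"
      using k by (intro power_increasing) auto
    also have "\<dots> \<le> real (n choose k)"
      using k by (intro binomial_ge_n_over_k_pow_k) auto
    finally have "real n ^ Suc K / real (n choose k) \<le> real k ^ Suc K"
      using k by (simp add: power_divide divide_simps mult_ac del: power_Suc)
    then have "real n ^ Suc K / real (n choose k) * (real (Sym_sum_no_ones k) / fact k)
        \<le> real k ^ Suc K * (real (Sym_sum_no_ones k) / fact k)"
      by (rule mult_right_mono) simp
    also have "\<dots> \<le> C * (1 / 2) ^ k"
      unfolding C_def by (rule weighted_Sym_sum_no_ones_le)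
    finally show "real n ^ Suc K * (real (Sym_sum_no_ones k) / fact k / real (n choose k))
        \<le> C * (1 / 2) ^ k"
      by (simp add: mult_ac)
  qed
  also have "\<dots> = C * (\<Sum>k\<in>{K<..<n}. (1 / 2) ^ k)" by (simp add: sum_distrib_left)
  also have "\<dots> \<le> C * (\<Sum>k. (1 / 2) ^ k)"
    by (intro mult_left_mono sum_le_suminf) (auto simp: C_def)
  also have "\<dots> = 2 * C" by (simp add: suminf_geometric)
  finally show "real n ^ Suc K * (Z31' n - S31' K n) \<le> 96 * fact (Suc K) * exp (48\<^sup>2)"
    by (simp add: C_def)
qed

theorem theorem1:
  fixes K :: nat
  shows "(\<lambda>n. real n ^ K * (Z31' n - S31' K n)) \<longlonglongrightarrow> 0"
proof (rule tendsto_sandwich)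
  define C :: real where "C = 96 * fact (Suc K) * exp (48\<^sup>2)"
  show "\<forall>\<^sub>F n in sequentially. 0 \<le> real n ^ K * (Z31' n - S31' K n)"
    using eventually_gt_at_top[of K] by eventually_elim (intro mult_nonneg_nonneg Z31'_minus_S31'_bounds(1); simp)
  \<comment> \<open>Dividing the bound for the exponent \<open>Suc K\<close> by \<open>n\<close>
    gives the rate \<open>C / real n\<close>.\<close>
  show "\<forall>\<^sub>F n in sequentially. real n ^ K * (Z31' n - S31' K n) \<le> C / real n"
    using eventually_gt_at_top[of K]
  proof eventually_elim
    case (elim n)
    then show ?case
      using Z31'_minus_S31'_bounds(2)[of K n] by (simp add: C_def field_simps)
  qed
  show "(\<lambda>n. C / real n) \<longlonglongrightarrow> 0" by (rule lim_const_over_n)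
qed simp

end
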